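(* In the setting described in the context, assume (A1) and (A2). Let $\mathcal{C}[x]\subset\mathbb{R}[x]$ and $\mathcal{C}[y]\subset\mathbb{R}[y]$ be convex cones with $\mathcal{C}[y]\subseteq\mathscr{P}(\mathbf{Y})$, and let $r^{\mathrm{primal}}$, $r^{\mathrm{dual}}$ be the optimal values of the conic problems (P) and (D) given in the context. Suppose that for some $\varepsilon\ge 0$ there exists $u^{(\varepsilon)}\in\mathbf{S}_\varepsilon$ such that $-p(u^{(\varepsilon)},y)\in\mathcal{C}[y]$ and $h(u^{(\varepsilon)})\ge 0$ for every $h\in\mathcal{C}[x]$. Then: (i) If (A3) holds (with $\mu^{\star},\eta^{\star}$ as there) and $L_{f,g}(x,\mu^{\star},\eta^{\star})+\varepsilon g(x)\in\mathcal{C}[x]$, then $r^{\star}-\varepsilon\le r^{\mathrm{primal}}\le r^{\mathrm{dual}}\le r^{\star}+\varepsilon$. (ii) If $\mathscr{L}^{\star}$ is a minimizer of (D) such that the restriction $\mathscr{L}^{\star}|_{\mathbb{R}[x]_{\mathbf{d}}}$ admits a representing nonnegative measure $\nu$, then $r^{\star}\le r^{\mathrm{dual}}\le r^{\star}+\varepsilon$ and $$\frac{\mathscr{L}^{\star}(x)}{\mathscr{L}^{\star}(1)}=\frac{1}{\int d\nu}\left(\int x_1\,d\nu,\dots,\int x_m\,d\nu\right)\in\mathbf{S}_{\varepsilon}.$$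
   Context: Let $x=(x_1,\dots,x_m)$, $y=(y_1,\dots,y_n)$, $f,g,\psi_1,\dots,\psi_s\in\mathbb{R}[x]$, $p\in\mathbb{R}[x,y]$, $\mathbf{Y}\subset\mathbb{R}^n$. Let $\mathbf{K}:=\{x\in\mathbb{R}^m:\psi_1(x)\le 0,\dots,\psi_s(x)\le 0,\ p(x,y)\le 0\ \forall y\in\mathbf{Y}\}$, $r^{\star}:=\min_{x\in\mathbf{K}} f(x)/g(x)$, and let $\mathbf{S}$ be the set of minimizers of $f/g$ on $\mathbf{K}$. It is assumed throughout that $\mathbf{S}\neq\emptyset$. For $\varepsilon\ge 0$, $\mathbf{S}_{\varepsilon}:=\{x\in\mathbf{K}: f(x)/g(x)\le r^{\star}+\varepsilon\}$. (A1): $\mathbf{Y}$ is compact; $f$, $-g$, each $\psi_i$, and $p(\cdot,y)$ for each $y\in\mathbf{Y}$ are convex in $x$. (A2): Either $f(x)\ge 0$ and $g(x)>0$ for all $x\in\mathbf{K}$; or $g$ is affine and $g(x)>0$ for all $x\in\mathbf{K}$. $\mathcal{M}(\mathbf{Y})$ denotes the set of finite nonnegative (Borel) measures supported on $\mathbf{Y}$. For $\mu\in\mathcal{M}(\mathbf{Y})$ and $\eta\in\mathbb{R}_+^s$ put $$L_{f,g}(x,\mu,\eta)=f(x)-r^{\star}g(x)+\int_{\mathbf{Y}}p(x,y)\,d\mu(y)+\sum_{j=1}^s\eta_j\psi_j(x).$$ (A3): There exist $\mu^{\star}\in\mathcal{M}(\mathbf{Y})$ and $\eta^{\star}\in\mathbb{R}_+^s$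 such that $\inf_{x\in\mathbb{R}^m}L_{f,g}(x,\mu^{\star},\eta^{\star})=0$. $\mathscr{P}(\mathbf{Y})\subset\mathbb{R}[y]$ is the cone of polynomials nonnegative on $\mathbf{Y}$. For a convex cone $C$ in $\mathbb{R}[x]$ (or $\mathbb{R}[y]$), $C^*$ denotes the set of linear functionals on $\mathbb{R}[x]$ (or $\mathbb{R}[y]$) that are nonnegative on $C$. For a linear functional $\mathscr{L}$ on $\mathbb{R}[x]$ (resp. $\mathscr{H}$ on $\mathbb{R}[y]$), $\mathscr{L}(p(x,y))\in\mathbb{R}[y]$ (resp. $\mathscr{H}(p(x,y))\in\mathbb{R}[x]$) is obtained by applying the functional to $p$ regarded as a polynomial in $x$ with coefficients in $\mathbb{R}[y]$ (resp. in $y$ with coefficients in $\mathbb{R}[x]$). Write $\mathscr{L}(x):=(\mathscr{L}(x_1),\dots,\mathscr{L}(x_m))$. The conic problems are $$\text{(P)}\quad r^{\mathrm{primal}}:=\sup_{\rho,\mathscr{H},\eta}\Big\{\rho: f(x)-\rho g(x)+\mathscr{H}(p(x,y))+\sum_{j=1}^s\eta_j\psi_j(x)\in\mathcal{C}[x],\ \rho\in\mathbb{R},\ \mathscr{H}\in(\mathcal{C}[y])^*,\ \eta\in\mathbb{R}_+^s\Big\},$$ $$\text{(D)}\quad r^{\mathrm{dual}}:=\inf_{\mathscr{L}}\Big\{\mathscr{L}(f): \mathscr{L}\in(\mathcal{C}[x])^*,\ \mathscr{L}(g)=1,\ -\mathscr{L}(p(x,y))\in\mathcal{C}[y],\ \mathscr{L}(\psi_j)\le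 0,\ j=1,\dots,s\Big\}.$$ $\mathbf{d}:=\max\{\deg f,\deg g,\deg\psi_1,\dots,\deg\psi_s,\deg_x p(x,y)\}$, and $\mathbb{R}[x]_{\mathbf{d}}$ is the space of polynomials of degree at most $\mathbf{d}$. A functional $\mathscr{L}$ on $\mathbb{R}[x]_{\mathbf{d}}$ has representing measure $\nu$ if $\nu$ is a Borel measure on $\mathbb{R}^m$ with $\mathscr{L}(x^\alpha)=\int x^\alpha d\nu$ for all $|\alpha|\le\mathbf{d}$.
   Formalization: In (ii) the equality of L*(x)/L*(1) with the normalized first moments of ν is stated only for d ≥ 1, since for d = 0 ν does not determine L*(x_i) and the equality fails (f=0, g=1, p=0, s=0); all other conclusions hold for every d. *)

theory Defs
  imports "HOL-Analysis.Analysis" "HOL-Library.Poly_Mapping"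
begin

abbreviation lookup where "lookup \<equiv> Poly_Mapping.lookup"
abbreviation keys where "keys \<equiv> Poly_Mapping.keys"

section \<open>Real polynomials in finitely many variables\<close>

text \<open>
  The variables are indexed by a finite type. An exponent vector is a finitely supported
  \<^typ>\<open>'m \<Rightarrow>\<^sub>0 nat\<close>, and a polynomial in \<open>\<real>[x]\<close> maps exponents to coefficients.
  \<open>\<real>[x,y]\<close> is the monoid algebra over pairs of exponents \<open>(\<alpha>, \<beta>)\<close>, which stand for
  \<open>x\<^sup>\<alpha> y\<^sup>\<beta>\<close>.
\<close>

type_synonym 'm mpoly = "('m \<Rightarrow>\<^sub>0 nat) \<Rightarrow>\<^sub>0 real"
type_synonym ('m, 'n) bipoly = "('m \<Rightarrow>\<^sub>0 nat) \<times> ('n \<Rightarrow>\<^sub>0 nat) \<Rightarrow>\<^sub>0 real"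

instantiation poly_mapping :: (type, real_vector) real_vector
begin

lift_definition scaleR_poly_mapping :: "real \<Rightarrow> ('a \<Rightarrow>\<^sub>0 'b) \<Rightarrow> ('a \<Rightarrow>\<^sub>0 'b)"
  is "\<lambda>c q k. c *\<^sub>R q k"
  by (erule finite_subset[rotated]) auto

instance
  by standard (transfer; auto simp: fun_eq_iff algebra_simps)+

end

lemma lookup_scaleR [simp]: "lookup (c *\<^sub>R q) k = c *\<^sub>R lookup q k"
  by transfer simp

definition mon :: "('m \<Rightarrow>\<^sub>0 nat) \<Rightarrow> 'm mpoly" where
  "mon \<alpha> = Poly_Mapping.single \<alpha> 1"

definition Var :: "'m \<Rightarrow> 'm mpoly" where
  "Var i = mon (Poly_Mapping.single i 1)"

definition eval_mon :: "('m::finite \<Rightarrow>\<^sub>0 nat) \<Rightarrow> real ^ 'm \<Rightarrow> real" where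
  "eval_mon \<alpha> x = (\<Prod>i\<in>UNIV. x $ i ^ lookup \<alpha> i)"

definition peval :: "'m::finite mpoly \<Rightarrow> real ^ 'm \<Rightarrow> real" where
  "peval q x = (\<Sum>\<alpha>\<in>keys q. lookup q \<alpha> * eval_mon \<alpha> x)"

definition peval2 :: "('m::finite, 'n::finite) bipoly \<Rightarrow> real ^ 'm \<Rightarrow> real ^ 'n \<Rightarrow> real" where
  "peval2 p x y = (\<Sum>(\<alpha>, \<beta>)\<in>keys p. lookup p (\<alpha>, \<beta>) * eval_mon \<alpha> x * eval_mon \<beta> y)"

definition mon_degree :: "('m::finite \<Rightarrow>\<^sub>0 nat) \<Rightarrow> nat" where
  "mon_degree \<alpha> = (\<Sum>i\<in>UNIV. lookup \<alpha> i)"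

text \<open>The zero polynomial gets degree 0.\<close>

definition total_degree :: "'m::finite mpoly \<Rightarrow> nat" where
  "total_degree q = Max (insert 0 (mon_degree ` keys q))"

definition degree_x :: "('m::finite, 'n::finite) bipoly \<Rightarrow> nat" where
  "degree_x p = Max (insert 0 ((\<lambda>(\<alpha>, \<beta>). mon_degree \<alpha>) ` keys p))"

text \<open>
  For \<open>p = (\<Sum>(\<alpha>, \<beta>). c \<alpha> \<beta> x\<^sup>\<alpha> y\<^sup>\<beta>)\<close>, the functional in \<open>x\<close> yields
  \<open>(\<Sum>(\<alpha>, \<beta>). c \<alpha> \<beta> \<L>(x\<^sup>\<alpha>) y\<^sup>\<beta>)\<close> in \<open>\<real>[y]\<close>; likewise in \<open>y\<close>.
\<close>

definition apply_x :: "('m mpoly \<Rightarrow> real) \<Rightarrow> ('m, 'n) bipoly \<Rightarrow> 'n mpoly" where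
  "apply_x L p = (\<Sum>(\<alpha>, \<beta>)\<in>keys p. (lookup p (\<alpha>, \<beta>) * L (mon \<alpha>)) *\<^sub>R mon \<beta>)"

definition apply_y :: "('n mpoly \<Rightarrow> real) \<Rightarrow> ('m, 'n) bipoly \<Rightarrow> 'm mpoly" where
  "apply_y H p = (\<Sum>(\<alpha>, \<beta>)\<in>keys p. (lookup p (\<alpha>, \<beta>) * H (mon \<beta>)) *\<^sub>R mon \<alpha>)"

text \<open>The polynomial \<open>p(u, y)\<close> in \<open>\<real>[y]\<close>.\<close>

definition subst_x :: "('m::finite, 'n) bipoly \<Rightarrow> real ^ 'm \<Rightarrow> 'n mpoly" where
  "subst_x p u = apply_x (\<lambda>q. peval q u) p"


section \<open>The fractional semi-infinite program\<close>

text \<open>The polynomials \<open>\<psi>\<^sub>1, \<dots>, \<psi>\<^sub>s\<close> are the values of \<open>\<psi>\<close> on \<open>{1..s}\<close>.\<close>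

definition feasible ::
  "(nat \<Rightarrow> 'm::finite mpoly) \<Rightarrow> nat \<Rightarrow> ('m, 'n::finite) bipoly \<Rightarrow> (real ^ 'n) set
    \<Rightarrow> (real ^ 'm) set" where
  "feasible \<psi> s p Y =
     {x. (\<forall>j\<in>{1..s}. peval (\<psi> j) x \<le> 0) \<and> (\<forall>y\<in>Y. peval2 p x y \<le> 0)}"

definition minimizers ::
  "'m::finite mpoly \<Rightarrow> 'm mpoly \<Rightarrow> (real ^ 'm) set \<Rightarrow> (real ^ 'm) set" where
  "minimizers f g K = {x. is_arg_min (\<lambda>x. peval f x / peval g x) (\<lambda>x. x \<in> K) x}"

text \<open>This infimum is a minimum whenever \<open>minimizers f g K\<close> is nonempty.\<close>

definition rstar :: "'m::finite mpoly \<Rightarrow> 'm mpoly \<Rightarrow> (real ^ 'm) set \<Rightarrow> real" where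
  "rstar f g K = (INF x\<in>K. peval f x / peval g x)"

definition eps_minimizers ::
  "'m::finite mpoly \<Rightarrow> 'm mpoly \<Rightarrow> (real ^ 'm) set \<Rightarrow> real \<Rightarrow> (real ^ 'm) set" where
  "eps_minimizers f g K \<epsilon> = {x \<in> K. peval f x / peval g x \<le> rstar f g K + \<epsilon>}"

definition assmA1 ::
  "'m::finite mpoly \<Rightarrow> 'm mpoly \<Rightarrow> (nat \<Rightarrow> 'm mpoly) \<Rightarrow> nat
    \<Rightarrow> ('m, 'n::finite) bipoly \<Rightarrow> (real ^ 'n) set \<Rightarrow> bool" where
  "assmA1 f g \<psi> s p Y \<longleftrightarrow>
     compact Y \<and> convex_on UNIV (peval f) \<and> convex_on UNIV (\<lambda>x. - peval g x) \<and>
     (\<forall>j\<in>{1..s}. convex_on UNIV (peval (\<psi> j))) \<and>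
     (\<forall>y\<in>Y. convex_on UNIV (\<lambda>x. peval2 p x y))"

definition affine_fun :: "(real ^ 'm::finite \<Rightarrow> real) \<Rightarrow> bool" where
  "affine_fun h \<longleftrightarrow> (\<exists>a b. \<forall>x. h x = a \<bullet> x + b)"

definition assmA2 :: "'m::finite mpoly \<Rightarrow> 'm mpoly \<Rightarrow> (real ^ 'm) set \<Rightarrow> bool" where
  "assmA2 f g K \<longleftrightarrow>
     (\<forall>x\<in>K. peval f x \<ge> 0 \<and> peval g x > 0) \<or>
     (affine_fun (peval g) \<and> (\<forall>x\<in>K. peval g x > 0))"

definition measures_on :: "(real ^ 'n::finite) set \<Rightarrow> (real ^ 'n) measure set" where
  "measures_on Y = {\<mu>. sets \<mu> = sets borel \<and> finite_measure \<mu> \<and> (AE y in \<mu>. y \<in> Y)}"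

definition lagrangian ::
  "'m::finite mpoly \<Rightarrow> 'm mpoly \<Rightarrow> (nat \<Rightarrow> 'm mpoly) \<Rightarrow> nat
    \<Rightarrow> ('m, 'n::finite) bipoly \<Rightarrow> (real ^ 'n) set
    \<Rightarrow> (real ^ 'n) measure \<Rightarrow> (nat \<Rightarrow> real) \<Rightarrow> real ^ 'm \<Rightarrow> real" where
  "lagrangian f g \<psi> s p Y \<mu> \<eta> x =
     peval f x - rstar f g (feasible \<psi> s p Y) * peval g x
       + (LINT y:Y|\<mu>. peval2 p x y) + (\<Sum>j=1..s. \<eta> j * peval (\<psi> j) x)"

text \<open>
  The same Lagrangian as an element of \<open>\<real>[x]\<close>: the integral over \<open>y\<close> is taken
  coefficientwise. See lemma \<open>peval_lagrangian_poly\<close> below.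
\<close>

definition lagrangian_poly ::
  "'m::finite mpoly \<Rightarrow> 'm mpoly \<Rightarrow> (nat \<Rightarrow> 'm mpoly) \<Rightarrow> nat
    \<Rightarrow> ('m, 'n::finite) bipoly \<Rightarrow> (real ^ 'n) set
    \<Rightarrow> (real ^ 'n) measure \<Rightarrow> (nat \<Rightarrow> real) \<Rightarrow> 'm mpoly" where
  "lagrangian_poly f g \<psi> s p Y \<mu> \<eta> =
     f - rstar f g (feasible \<psi> s p Y) *\<^sub>R g
       + apply_y (\<lambda>h. LINT y:Y|\<mu>. peval h y) p + (\<Sum>j=1..s. \<eta> j *\<^sub>R \<psi> j)"

text \<open>
  The infimum is taken in the extended reals, so that a Lagrangian unbounded below has
  infimum \<open>-\<infinity>\<close>.
\<close>

definition assmA3_witness ::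
  "'m::finite mpoly \<Rightarrow> 'm mpoly \<Rightarrow> (nat \<Rightarrow> 'm mpoly) \<Rightarrow> nat
    \<Rightarrow> ('m, 'n::finite) bipoly \<Rightarrow> (real ^ 'n) set
    \<Rightarrow> (real ^ 'n) measure \<Rightarrow> (nat \<Rightarrow> real) \<Rightarrow> bool" where
  "assmA3_witness f g \<psi> s p Y \<mu> \<eta> \<longleftrightarrow>
     \<mu> \<in> measures_on Y \<and> (\<forall>j\<in>{1..s}. \<eta> j \<ge> 0) \<and>
     (INF x. ereal (lagrangian f g \<psi> s p Y \<mu> \<eta> x)) = 0"


section \<open>The conic problems\<close>

definition nonneg_polys :: "(real ^ 'n::finite) set \<Rightarrow> 'n mpoly set" where
  "nonneg_polys Y = {h. \<forall>y\<in>Y. peval h y \<ge> 0}"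

definition dual_cone :: "'m mpoly set \<Rightarrow> ('m mpoly \<Rightarrow> real) set" where
  "dual_cone C = {L. linear L \<and> (\<forall>h\<in>C. L h \<ge> 0)}"

definition r_primal ::
  "'m mpoly \<Rightarrow> 'm mpoly \<Rightarrow> (nat \<Rightarrow> 'm mpoly) \<Rightarrow> nat \<Rightarrow> ('m, 'n) bipoly
    \<Rightarrow> 'm mpoly set \<Rightarrow> 'n mpoly set \<Rightarrow> ereal" where
  "r_primal f g \<psi> s p Cx Cy =
     Sup {ereal \<rho> | \<rho> H \<eta>.
       f - \<rho> *\<^sub>R g + apply_y H p + (\<Sum>j=1..s. \<eta> j *\<^sub>R \<psi> j) \<in> Cx \<and>
       H \<in> dual_cone Cy \<and> (\<forall>j\<in>{1..s}. (\<eta> j :: real) \<ge> 0)}"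

definition dual_feasible ::
  "'m mpoly \<Rightarrow> (nat \<Rightarrow> 'm mpoly) \<Rightarrow> nat \<Rightarrow> ('m, 'n) bipoly
    \<Rightarrow> 'm mpoly set \<Rightarrow> 'n mpoly set \<Rightarrow> ('m mpoly \<Rightarrow> real) set" where
  "dual_feasible g \<psi> s p Cx Cy =
     {L \<in> dual_cone Cx. L g = 1 \<and> - apply_x L p \<in> Cy \<and> (\<forall>j\<in>{1..s}. L (\<psi> j) \<le> 0)}"

definition r_dual ::
  "'m mpoly \<Rightarrow> 'm mpoly \<Rightarrow> (nat \<Rightarrow> 'm mpoly) \<Rightarrow> nat \<Rightarrow> ('m, 'n) bipoly
    \<Rightarrow> 'm mpoly set \<Rightarrow> 'n mpoly set \<Rightarrow> ereal" where
  "r_dual f g \<psi> s p Cx Cy = (INF L\<in>dual_feasible g \<psi> s p Cx Cy. ereal (L f))"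

definition dual_minimizer ::
  "'m mpoly \<Rightarrow> 'm mpoly \<Rightarrow> (nat \<Rightarrow> 'm mpoly) \<Rightarrow> nat \<Rightarrow> ('m, 'n) bipoly
    \<Rightarrow> 'm mpoly set \<Rightarrow> 'n mpoly set \<Rightarrow> ('m mpoly \<Rightarrow> real) \<Rightarrow> bool" where
  "dual_minimizer f g \<psi> s p Cx Cy L \<longleftrightarrow>
     is_arg_min (\<lambda>L. L f) (\<lambda>L. L \<in> dual_feasible g \<psi> s p Cx Cy) L"

definition max_degree ::
  "'m::finite mpoly \<Rightarrow> 'm mpoly \<Rightarrow> (nat \<Rightarrow> 'm mpoly) \<Rightarrow> nat
    \<Rightarrow> ('m, 'n::finite) bipoly \<Rightarrow> nat" where
  "max_degree f g \<psi> s p =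
     Max ({total_degree f, total_degree g, degree_x p} \<union> (\<lambda>j. total_degree (\<psi> j)) ` {1..s})"

text \<open>
  Integrability of the monomials has to be requested explicitly, since the Bochner integral of
  a non-integrable function is 0. With \<open>\<alpha> = 0\<close> it makes \<open>\<nu>\<close> finite.
\<close>

definition represents ::
  "nat \<Rightarrow> (real ^ 'm::finite) measure \<Rightarrow> ('m mpoly \<Rightarrow> real) \<Rightarrow> bool" where
  "represents d \<nu> L \<longleftrightarrow>
     sets \<nu> = sets borel \<and>
     (\<forall>\<alpha>. mon_degree \<alpha> \<le> d \<longrightarrow>
        integrable \<nu> (eval_mon \<alpha>) \<and> L (mon \<alpha>) = (LINT x|\<nu>. eval_mon \<alpha> x))"


section \<open>Consistency of the two forms of the Lagrangian\<close>

lemma peval_superset: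
  "finite A \<Longrightarrow> keys q \<subseteq> A \<Longrightarrow> peval q x = (\<Sum>\<alpha>\<in>A. lookup q \<alpha> * eval_mon \<alpha> x)"
  unfolding peval_def by (rule sum.mono_neutral_left) (auto simp: in_keys_iff)

lemma peval_add: "peval (q + r) x = peval q x + peval r x"
proof -
  have "keys (q + r) \<subseteq> keys q \<union> keys r"
    by (rule Poly_Mapping.keys_add)
  then show ?thesis
    by (simp add: peval_superset[of "keys q \<union> keys r"] lookup_add algebra_simps sum.distrib)
qed

lemma peval_scaleR: "peval (c *\<^sub>R q) x = c * peval q x"
proof -
  have "keys (c *\<^sub>R q) \<subseteq> keys q"
    by (auto simp: in_keys_iff)
  then show ?thesis
    by (simp add: peval_superset[of "keys q"] sum_distrib_left mult.assoc)
qed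

lemma linear_peval: "linear (\<lambda>q. peval q x)"
  by (rule linearI) (simp_all add: peval_add peval_scaleR)

lemma peval_mon [simp]: "peval (mon \<alpha>) = eval_mon \<alpha>"
  by (simp add: fun_eq_iff peval_def mon_def)

lemma integrable_eval_mon_on:
  assumes "compact Y" "\<mu> \<in> measures_on Y"
  shows "set_integrable \<mu> Y (eval_mon \<beta>)"
proof -
  interpret finite_measure \<mu>
    using assms by (simp add: measures_on_def)
  have sets: "sets \<mu> = sets borel"
    using assms by (simp add: measures_on_def)
  have cont: "continuous_on UNIV (eval_mon \<beta>)"
    unfolding eval_mon_def by (intro continuous_intros)
  then have "bounded (eval_mon \<beta> ` Y)"
    using assms(1) by (meson compact_continuous_image compact_imp_bounded
        continuous_on_subset subset_UNIV)
  then obtain B where B: "B > 0" "\<And>y. y \<in> Y \<Longrightarrow> norm (eval_mon \<beta> y) \<le> B"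
    unfolding bounded_pos by blast
  have "eval_mon \<beta> \<in> borel_measurable \<mu>"
    using borel_measurable_continuous_onI[OF cont] measurable_cong_sets[OF sets refl] by blast
  moreover have "Y \<in> sets \<mu>"
    using assms(1) sets by (simp add: borel_compact)
  ultimately show ?thesis
    unfolding set_integrable_def
    by (intro integrable_const_bound[where B = B])
      (use B in \<open>auto simp: indicator_def\<close>)
qed

lemma peval_lagrangian_poly:
  assumes "compact Y" "\<mu> \<in> measures_on Y"
  shows "peval (lagrangian_poly f g \<psi> s p Y \<mu> \<eta>) x = lagrangian f g \<psi> s p Y \<mu> \<eta> x"
proof -
  note int = integrable_eval_mon_on[OF assms]
  have "(LINT y:Y|\<mu>. peval2 p x y) =
      (\<Sum>(\<alpha>, \<beta>)\<in>keys p. LINT y:Y|\<mu>. lookup p (\<alpha>, \<beta>) * eval_mon \<alpha> x * eval_mon \<beta> y)"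
    unfolding peval2_def set_lebesgue_integral_def scaleR_sum_right split_def
    using int unfolding set_integrable_def
    by (subst Bochner_Integration.integral_sum)
       (auto simp: mult.left_commute[of "indicat_real Y _"])
  also have "\<dots> = peval (apply_y (\<lambda>h. LINT y:Y|\<mu>. peval h y) p) x"
    unfolding apply_y_def
    by (subst linear_sum[OF linear_peval])
       (auto simp: peval_scaleR split_def mult_ac intro!: sum.cong)
  finally show ?thesis
    unfolding lagrangian_def lagrangian_poly_def
    by (simp add: peval_add peval_scaleR linear_diff[OF linear_peval] linear_sum[OF linear_peval])
qed

end

theory Submission
  imports Defs
begin

text \<open>
  The hypothesis on \<open>u\<close> makes the scaled point evaluation \<open>h \<mapsto> h(u) / g(u)\<close> feasible for (D),
  which gives the upper bound on \<open>r_dual\<close>; integration against \<open>\<mu>\<close> together with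
  \<open>\<rho> = r\<^sup>\<star> - \<epsilon>\<close> and \<open>\<eta>\<close> is feasible for (P), which gives the lower bound on \<open>r_primal\<close>.
  Weak duality rests on \<open>\<L>(\<H>(p)) = \<H>(\<L>(p))\<close>. For (ii), Jensen's inequality for \<open>\<nu>\<close> applied to
  \<open>\<psi>\<^sub>j\<close>, \<open>p(\<cdot>, y)\<close>, \<open>f\<close> and \<open>-g\<close> shows that the barycentre of \<open>\<nu>\<close> is feasible and that its objective
  value is at most \<open>\<L>\<^sup>\<star>(f)\<close>.
\<close>

section \<open>Linear functionals and representing measures\<close>

lemma sum_monomials: "q = (\<Sum>\<alpha>\<in>keys q. lookup q \<alpha> *\<^sub>R mon \<alpha>)"
proof (rule poly_mapping_eqI)
  fix k
  show "lookup q k = lookup (\<Sum>\<alpha>\<in>keys q. lookup q \<alpha> *\<^sub>R mon \<alpha>) k"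
    by (auto simp: lookup_sum mon_def lookup_single when_def in_keys_iff
        if_distrib[of "(*) _"] sum.delta' cong: if_cong)
qed

lemma linear_on_monomials:
  fixes L :: "'m mpoly \<Rightarrow> real"
  assumes "linear L"
  shows "L q = (\<Sum>\<alpha>\<in>keys q. lookup q \<alpha> * L (mon \<alpha>))"
  by (subst sum_monomials) (simp add: linear_sum[OF assms] linear_scale[OF assms])

text \<open>Both sides expand to the sum of \<open>lookup p (\<alpha>, \<beta>) * L (mon \<alpha>) *
  H (mon \<beta>)\<close>. It serves weak duality with \<open>H\<close> from (P), and feasibility of
  the barycentre with \<open>H\<close> the evaluation at a point \<open>y\<close>.\<close>

lemma linear_apply_y_eq_apply_x:
  assumes L: "linear L" and H: "linear H"
  shows "L (apply_y H p) = H (apply_x L p)"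
  unfolding apply_y_def apply_x_def
  by (simp add: linear_sum[OF L] linear_sum[OF H] linear_scale[OF L] linear_scale[OF H]
      split_def mult_ac)

text \<open>Provides p(x, y) for fixed \<open>y\<close> as an element of \<real>[x], so that
  \<open>L\<close> and Jensen's inequality for polynomials apply to it.\<close>

lemma peval_apply_y_peval: "peval (apply_y (\<lambda>h. peval h y) p) x = peval2 p x y"
  unfolding apply_y_def peval2_def
  by (simp add: linear_sum[OF linear_peval] peval_scaleR split_def mult_ac)

section \<open>Degree bounds and monomials of degree 0 and 1\<close>

lemma mon_degree_le_total_degree: "\<alpha> \<in> keys q \<Longrightarrow> mon_degree \<alpha> \<le> total_degree q"
  unfolding total_degree_def by simp

text \<open>A surviving monomial must be the first component of some key of \<open>p\<close>;
  cancellation can only remove monomials. Hence p(x, y) stays within the degrees on which \<nu>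
  represents \<open>L\<close>.\<close>

lemma total_degree_apply_y_le: "total_degree (apply_y H p) \<le> degree_x p"
proof -
  have "mon_degree \<alpha> \<le> degree_x p" if "\<alpha> \<in> keys (apply_y H p)" for \<alpha>
  proof -
    have "lookup (apply_y H p) \<alpha> \<noteq> 0"
      using that by (simp add: in_keys_iff)
    then have "(\<Sum>ab\<in>keys p. lookup ((lookup p ab * H (mon (snd ab))) *\<^sub>R mon (fst ab)) \<alpha>) \<noteq> 0"
      by (simp add: apply_y_def lookup_sum split_def)
    then obtain ab where ab: "ab \<in> keys p"
      "lookup ((lookup p ab * H (mon (snd ab))) *\<^sub>R mon (fst ab)) \<alpha> \<noteq> 0"
      by (rule sum.not_neutral_contains_not_neutral)
    then have "fst ab = \<alpha>"
      by (auto simp: mon_def lookup_single when_def split: if_splits)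
    then show ?thesis
      unfolding degree_x_def using ab(1) by (auto simp: split_def intro!: Max_ge rev_image_eqI[of ab])
  qed
  then show ?thesis
    unfolding total_degree_def by simp
qed

lemma eval_mon_0 [simp]: "eval_mon 0 = (\<lambda>x. 1)"
  by (simp add: eval_mon_def fun_eq_iff)

lemma eval_mon_single: "eval_mon (Poly_Mapping.single i 1) x = x $ i"
proof -
  have "eval_mon (Poly_Mapping.single i 1) x = (\<Prod>j\<in>UNIV. if j = i then x $ i else 1)"
    unfolding eval_mon_def by (intro prod.cong) (auto simp: lookup_single)
  then show ?thesis by simp
qed

lemma mon_degree_single: "mon_degree (Poly_Mapping.single i 1) = 1"
  unfolding mon_degree_def by (simp add: lookup_single when_def)

lemma mon_degree_0 [simp]: "mon_degree 0 = 0"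
  by (simp add: mon_degree_def)

lemma mon_degree_eq_0_iff: "mon_degree \<alpha> = 0 \<longleftrightarrow> \<alpha> = 0"
  unfolding mon_degree_def by (auto intro: poly_mapping_eqI)

lemma peval_total_degree_0:
  assumes "total_degree q = 0"
  shows "peval q x = peval q z"
proof -
  have "\<alpha> = 0" if "\<alpha> \<in> keys q" for \<alpha>
    using mon_degree_le_total_degree[OF that] assms by (simp add: mon_degree_eq_0_iff)
  then have "eval_mon \<alpha> x = eval_mon \<alpha> z" if "\<alpha> \<in> keys q" for \<alpha>
    using that by fastforce
  then show ?thesis
    unfolding peval_def by simp
qed

section \<open>Consequences of a representing measure\<close>

lemma representsD:
  assumes rep: "represents d \<nu> L" and L: "linear L" and q: "total_degree q \<le> d"
  shows "integrable \<nu> (peval q)" and "L q = (LINT x|\<nu>. peval q x)"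
proof -
  have *: "integrable \<nu> (eval_mon \<alpha>)" "L (mon \<alpha>) = (LINT x|\<nu>. eval_mon \<alpha> x)"
    if "\<alpha> \<in> keys q" for \<alpha>
    using rep mon_degree_le_total_degree[OF that] q unfolding represents_def by auto
  show "integrable \<nu> (peval q)"
    unfolding peval_def[abs_def] using * by auto
  show "L q = (LINT x|\<nu>. peval q x)"
    unfolding peval_def using *
    by (subst linear_on_monomials[OF L], subst Bochner_Integration.integral_sum) auto
qed

lemma mon_0: "mon 0 = 1"
  by (simp add: mon_def)

lemma represents_mass:
  assumes "represents d \<nu> L"
  shows "integrable \<nu> (\<lambda>x. 1 :: real)" and "L 1 = (LINT x|\<nu>. 1)"
proof -
  have "integrable \<nu> (eval_mon 0)" "L (mon 0) = (LINT x|\<nu>. eval_mon 0 x)"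
    using assms unfolding represents_def by (simp_all del: eval_mon_0)
  then show "integrable \<nu> (\<lambda>x. 1 :: real)" "L 1 = (LINT x|\<nu>. 1)"
    by (simp_all add: mon_0)
qed

lemma represents_Var:
  assumes "represents d \<nu> L" "d \<ge> 1"
  shows "integrable \<nu> (\<lambda>x. x $ i)" and "L (Var i) = (LINT x|\<nu>. x $ i)"
proof -
  have "mon_degree (Poly_Mapping.single i 1) \<le> d"
    unfolding mon_degree_single using assms(2) .
  then have "integrable \<nu> (eval_mon (Poly_Mapping.single i 1))"
    "L (Var i) = (LINT x|\<nu>. eval_mon (Poly_Mapping.single i 1) x)"
    using assms(1) unfolding represents_def Var_def by auto
  then show "integrable \<nu> (\<lambda>x. x $ i)" "L (Var i) = (LINT x|\<nu>. x $ i)"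
    by (simp_all only: eval_mon_single[abs_def])
qed

text \<open>A measure of mass zero integrates everything to zero, contradicting
  \<open>L q \<noteq> 0\<close>. Applied with \<open>q = g\<close>, where \<open>L g = 1\<close>; it
  makes division by \<open>L 1\<close> meaningful.\<close>

lemma represents_mass_pos:
  assumes rep: "represents d \<nu> L" and L: "linear L"
    and q: "total_degree q \<le> d" "L q \<noteq> 0"
  shows "L 1 > 0"
proof (rule ccontr)
  note mass = represents_mass[OF rep]
  assume "\<not> L 1 > 0"
  moreover have "L 1 \<ge> 0"
    unfolding mass(2) by simp
  ultimately have "(LINT x|\<nu>. 1 :: real) = 0"
    using mass(2) by linarith
  \<comment> \<open>A false statement holding almost everywhere: \<nu> is null, so every property
    holds almost everywhere.\<close>
  then have "AE x in \<nu>. (1 :: real) = 0"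
    using integral_nonneg_eq_0_iff_AE[OF mass(1)] by simp
  then have "AE x in \<nu>. peval q x = 0"
    by eventually_elim simp
  then have "(LINT x|\<nu>. peval q x) = 0"
    by (rule integral_eq_zero_AE)
  then show False
    using q representsD(2)[OF rep L q(1)] by simp
qed


section \<open>Jensen's inequality\<close>

text \<open>Restriction to the line through \<open>c\<close> and \<open>x\<close> reduces this to
  the tangent inequality in one real variable, based at 0 and read off at 1.\<close>

lemma convex_on_ge_tangent:
  fixes F :: "'a::real_normed_vector \<Rightarrow> real"
  assumes F: "convex_on UNIV F" and D: "(F has_derivative D) (at c)"
  shows "F x \<ge> F c + D (x - c)"
proof -
  let ?\<phi> = "\<lambda>t. F (c + t *\<^sub>R (x - c))"
  have "convex_on UNIV ?\<phi>"
  proof (rule convex_onI)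
    fix t a b :: real
    assume "0 < t" "t < 1"
    moreover have "c + ((1 - t) *\<^sub>R a + t *\<^sub>R b) *\<^sub>R (x - c)
        = (1 - t) *\<^sub>R (c + a *\<^sub>R (x - c)) + t *\<^sub>R (c + b *\<^sub>R (x - c))"
      by (simp add: algebra_simps)
    ultimately show "?\<phi> ((1 - t) *\<^sub>R a + t *\<^sub>R b) \<le> (1 - t) * ?\<phi> a + t * ?\<phi> b"
      using convex_onD[OF F, of t "c + a *\<^sub>R (x - c)" "c + b *\<^sub>R (x - c)"] by simp
  qed simp
  moreover have "(?\<phi> has_real_derivative D (x - c)) (at 0)"
  proof -
    have "((\<lambda>t. c + t *\<^sub>R (x - c)) has_derivative (\<lambda>t. t *\<^sub>R (x - c))) (at 0)"
      by (auto intro!: derivative_eq_intros)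
    from has_derivative_compose[OF this, of F D] D
    have "(?\<phi> has_derivative (\<lambda>t. D (t *\<^sub>R (x - c)))) (at 0)"
      by simp
    moreover have "(\<lambda>t. D (t *\<^sub>R (x - c))) = (*) (D (x - c))"
      by (simp add: fun_eq_iff linear_scale[OF has_derivative_linear[OF D]])
    ultimately show ?thesis
      by (simp add: has_field_derivative_def)
  qed
  ultimately have "?\<phi> 1 - ?\<phi> 0 \<ge> D (x - c) * (1 - 0)"
    by (intro convex_on_imp_above_tangent[where A = UNIV]) auto
  then show ?thesis by simp
qed

text \<open>Integrate the tangent inequality at \<open>c\<close>: the linear part has integral zero
  because \<open>c\<close> is the barycentre. As \<nu> is not normalised, its mass appears as a
  factor.\<close>

lemma jensen_barycentre:
  fixes F :: "real ^ 'm::finite \<Rightarrow> real"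
  assumes F: "convex_on UNIV F" "F differentiable (at c)" "integrable \<nu> F"
    and mass: "integrable \<nu> (\<lambda>x. 1 :: real)"
    and coord: "\<And>i. integrable \<nu> (\<lambda>x. x $ i)"
    and c: "\<And>i. (LINT x|\<nu>. x $ i) = c $ i * (LINT x|\<nu>. 1)"
  shows "F c * (LINT x|\<nu>. 1) \<le> (LINT x|\<nu>. F x)"
proof -
  obtain D where D: "(F has_derivative D) (at c)"
    using F(2) unfolding differentiable_def by blast
  \<comment> \<open>The factors \<open>* 1\<close> present constants as multiples of the function 1,
    so that \<open>mass\<close> and \<open>c\<close> apply directly; hence
    \<open>mult_1_right\<close> is kept out of the simplifier when \<open>T\<close> is
    integrated.\<close>
  define T where "T x = F c * 1 + (\<Sum>i\<in>UNIV. D (axis i 1) * (x $ i - c $ i * 1))" for x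
  have T: "T x = F c + D (x - c)" for x
  proof -
    have "D (x - c) = D (\<Sum>i\<in>UNIV. (x - c) $ i *\<^sub>R axis i 1)"
      using basis_expansion[of "x - c"] by (simp add: scalar_mult_eq_scaleR)
    also have "\<dots> = (\<Sum>i\<in>UNIV. D (axis i 1) * (x $ i - c $ i))"
      using has_derivative_linear[OF D] by (simp add: linear_sum linear_scale mult.commute)
    finally show ?thesis by (simp add: T_def)
  qed
  have "integrable \<nu> T"
    unfolding T_def
    by (intro Bochner_Integration.integrable_add Bochner_Integration.integrable_sum
        integrable_mult_right Bochner_Integration.integrable_diff coord mass)
  moreover have "(LINT x|\<nu>. T x) = F c * (LINT x|\<nu>. 1)"
    unfolding T_def using mass coord c
    by (simp del: mult_1_right add: Bochner_Integration.integral_add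
        Bochner_Integration.integral_sum Bochner_Integration.integral_diff)
  moreover have "T x \<le> F x" for x
    unfolding T by (rule convex_on_ge_tangent[OF F(1) D])
  ultimately show ?thesis
    using integral_mono[of \<nu> T F] F(3) by simp
qed

lemma differentiable_prod:
  fixes F :: "'i \<Rightarrow> 'a::real_normed_vector \<Rightarrow> real"
  assumes "\<And>i. i \<in> A \<Longrightarrow> F i differentiable (at c)"
  shows "(\<lambda>x. \<Prod>i\<in>A. F i x) differentiable (at c)"
proof -
  obtain F' where "(F i has_derivative F' i) (at c)" if "i \<in> A" for i
    using assms unfolding differentiable_def by metis
  then show ?thesis
    unfolding differentiable_def using has_derivative_prod by blast
qed

lemma differentiable_peval: "peval q differentiable (at c)"
proof -
  have coord: "(\<lambda>x. x $ i) differentiable (at c)" for i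
    by (rule bounded_linear_imp_differentiable) (rule bounded_linear_vec_nth)
  have "eval_mon \<alpha> differentiable (at c)" for \<alpha>
    unfolding eval_mon_def[abs_def]
    by (intro differentiable_prod differentiable_power coord)
  then show ?thesis
    unfolding peval_def[abs_def] by (intro differentiable_sum differentiable_mult) auto
qed

text \<open>
  For \<open>d = 0\<close> the values \<open>L (Var i)\<close> are not controlled by \<open>\<nu>\<close>, but then \<open>q\<close> is constant.
\<close>

lemma represents_jensen:
  assumes rep: "represents d \<nu> L" and L: "linear L" and pos: "L 1 > 0"
    and q: "total_degree q \<le> d" "convex_on UNIV (peval q)"
  shows "peval q (\<chi> i. L (Var i) / L 1) * L 1 \<le> L q"
proof (cases "d = 0")
  case True
  let ?c = "\<chi> i. L (Var i) / L 1"
  have "L q = (LINT x|\<nu>. peval q ?c * 1)"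
    unfolding representsD(2)[OF rep L q(1)]
    by (intro Bochner_Integration.integral_cong) (use True q(1) peval_total_degree_0 in auto)
  also have "\<dots> = peval q ?c * L 1"
    unfolding represents_mass(2)[OF rep] by simp
  finally show ?thesis by simp
next
  case False
  then have d: "d \<ge> 1" by simp
  show ?thesis
    unfolding represents_mass(2)[OF rep] representsD(2)[OF rep L q(1)]
    using represents_Var[OF rep d] pos
    by (intro jensen_barycentre q(2) differentiable_peval representsD(1)[OF rep L q(1)]
        represents_mass(1)[OF rep])
      (simp_all add: represents_mass(2)[OF rep])
qed

text \<open>For affine \<open>g\<close> this gives Jensen's inequality for \<open>g\<close> itself,
  besides the one for \<open>-g\<close>.\<close>

lemma convex_on_affine_fun:
  assumes "affine_fun h"
  shows "convex_on UNIV h"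
proof -
  obtain a b where h: "h = (\<lambda>x. a \<bullet> x + b)"
    using assms unfolding affine_fun_def by blast
  show ?thesis
    unfolding h by (rule convex_onI) (auto simp: inner_right_distrib algebra_simps)
qed


section \<open>The conic problems\<close>

text \<open>A minimizer bounds the objective from below on \<open>K\<close>, so the real-valued
  \<open>INF\<close> is a genuine lower bound.\<close>

lemma rstar_le:
  assumes "minimizers f g K \<noteq> {}" "x \<in> K"
  shows "rstar f g K \<le> peval f x / peval g x"
proof -
  obtain z where z: "\<And>x. x \<in> K \<Longrightarrow> peval f z / peval g z \<le> peval f x / peval g x"
    using assms(1) unfolding minimizers_def is_arg_min_linorder by blast
  then have "bdd_below ((\<lambda>x. peval f x / peval g x) ` K)"
    by (auto intro!: bdd_belowI)
  then show ?thesis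
    unfolding rstar_def using assms(2) by (rule cINF_lower)
qed

text \<open>Apply \<open>L\<close> to the element of \<open>Cx\<close> in (P): with
  \<open>L g = 1\<close> and the last two terms nonpositive, \<open>\<rho> \<le> L f\<close>
  results. Infeasible problems are covered, having the values -\<infinity> and \<infinity>.\<close>

lemma weak_duality: "r_primal f g \<psi> s p Cx Cy \<le> r_dual f g \<psi> s p Cx Cy"
proof -
  have "\<rho> \<le> L f"
    if mem: "f - \<rho> *\<^sub>R g + apply_y H p + (\<Sum>j=1..s. \<eta> j *\<^sub>R \<psi> j) \<in> Cx"
      and H: "H \<in> dual_cone Cy" and \<eta>: "\<forall>j\<in>{1..s}. (\<eta> j :: real) \<ge> 0"
      and feas: "L \<in> dual_feasible g \<psi> s p Cx Cy" for \<rho> H \<eta> L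
  proof -
    have linL: "linear L" and linH: "linear H"
      using H feas unfolding dual_feasible_def dual_cone_def by auto
    have "0 \<le> L (f - \<rho> *\<^sub>R g + apply_y H p + (\<Sum>j=1..s. \<eta> j *\<^sub>R \<psi> j))"
      using mem feas unfolding dual_feasible_def dual_cone_def by auto
    also have "\<dots> = L f - \<rho> * L g + H (apply_x L p) + (\<Sum>j=1..s. \<eta> j * L (\<psi> j))"
      by (simp add: linear_add[OF linL] linear_diff[OF linL] linear_scale[OF linL]
          linear_sum[OF linL] linear_apply_y_eq_apply_x[OF linL linH])
    finally have "0 \<le> L f - \<rho> * L g + H (apply_x L p) + (\<Sum>j=1..s. \<eta> j * L (\<psi> j))" .
    moreover have "H (apply_x L p) \<le> 0"
    proof -
      have "0 \<le> H (- apply_x L p)"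
        using H feas unfolding dual_feasible_def dual_cone_def by auto
      then show ?thesis by (simp add: linear_neg[OF linH])
    qed
    moreover have "(\<Sum>j=1..s. \<eta> j * L (\<psi> j)) \<le> 0"
      using \<eta> feas unfolding dual_feasible_def
      by (intro sum_nonpos) (auto simp: mult_nonneg_nonpos)
    moreover have "L g = 1"
      using feas unfolding dual_feasible_def by auto
    ultimately show ?thesis by simp
  qed
  then show ?thesis
    unfolding r_primal_def r_dual_def by (auto intro!: Sup_least INF_greatest)
qed

lemma r_dual_le_point_evaluation:
  assumes Cy: "convex_cone Cy" and u: "u \<in> feasible \<psi> s p Y" "- subst_x p u \<in> Cy"
    "\<forall>h\<in>Cx. peval h u \<ge> 0" and g: "peval g u > 0"
  shows "r_dual f g \<psi> s p Cx Cy \<le> ereal (peval f u / peval g u)"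
proof -
  define L where "L h = peval h u / peval g u" for h
  have "linear L"
    unfolding L_def by (rule linearI) (simp_all add: peval_add peval_scaleR add_divide_distrib)
  \<comment> \<open>Scaling by 1/g(u), which secures \<open>L g = 1\<close>, stays inside the cone
    because g(u) is positive.\<close>
  moreover have "- apply_x L p = (1 / peval g u) *\<^sub>R (- subst_x p u)"
    unfolding subst_x_def apply_x_def L_def
    by (simp add: scaleR_sum_right split_def)
  then have "- apply_x L p \<in> Cy"
    using Cy u(2) g by (simp add: convex_cone_def conic_def del: scaleR_minus_right)
  ultimately have "L \<in> dual_feasible g \<psi> s p Cx Cy"
    using u g unfolding dual_feasible_def dual_cone_def feasible_def L_def
    by (auto simp: divide_nonpos_pos)
  then show ?thesis
    unfolding r_dual_def by (rule INF_lower2) (simp add: L_def)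
qed

text \<open>Supplies the functional \<open>H\<close> for (P). Additivity of the integral rests on
  integrability of polynomials over the compact \<open>Y\<close>; positivity holds as members of
  \<open>Cy\<close> are nonnegative on \<open>Y\<close>.\<close>

lemma integral_in_dual_cone:
  assumes Y: "compact Y" and \<mu>: "\<mu> \<in> measures_on Y" and Cy: "Cy \<subseteq> nonneg_polys Y"
  shows "(\<lambda>h. LINT y:Y|\<mu>. peval h y) \<in> dual_cone Cy"
proof -
  have int: "set_integrable \<mu> Y (peval h)" for h
  proof -
    have "set_integrable \<mu> Y (\<lambda>y. lookup h \<alpha> * eval_mon \<alpha> y)" for \<alpha>
      using integrable_eval_mon_on[OF Y \<mu>] by simp
    then show ?thesis
      unfolding set_integrable_def peval_def[abs_def] scaleR_sum_right
      by (intro Bochner_Integration.integrable_sum)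
  qed
  have "linear (\<lambda>h. LINT y:Y|\<mu>. peval h y)"
    by (rule linearI) (simp_all add: peval_add peval_scaleR set_integral_add(2)[OF int int])
  moreover have "0 \<le> (LINT y:Y|\<mu>. peval h y)" if "h \<in> Cy" for h
    unfolding set_lebesgue_integral_def
    by (rule Bochner_Integration.integral_nonneg)
      (use that Cy in \<open>auto simp: nonneg_polys_def indicator_def\<close>)
  ultimately show ?thesis
    by (simp add: dual_cone_def)
qed

lemma r_primal_ge:
  assumes A1: "assmA1 f g \<psi> s p Y" and Cy: "Cy \<subseteq> nonneg_polys Y"
    and wit: "assmA3_witness f g \<psi> s p Y \<mu> \<eta>"
    and mem: "lagrangian_poly f g \<psi> s p Y \<mu> \<eta> + \<epsilon> *\<^sub>R g \<in> Cx"
  shows "ereal (rstar f g (feasible \<psi> s p Y) - \<epsilon>) \<le> r_primal f g \<psi> s p Cx Cy"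
proof -
  let ?H = "\<lambda>h. LINT y:Y|\<mu>. peval h y"
  let ?\<rho> = "rstar f g (feasible \<psi> s p Y) - \<epsilon>"
  \<comment> \<open>The shift by \<epsilon> in \<open>?\<rho>\<close> is exactly the summand
    \<open>\<epsilon> *\<^sub>R g\<close> of \<open>mem\<close>.\<close>
  have "f - ?\<rho> *\<^sub>R g + apply_y ?H p + (\<Sum>j=1..s. \<eta> j *\<^sub>R \<psi> j) \<in> Cx"
    using mem unfolding lagrangian_poly_def by (simp add: algebra_simps)
  moreover have "?H \<in> dual_cone Cy"
    using A1 wit Cy unfolding assmA1_def assmA3_witness_def
    by (intro integral_in_dual_cone) auto
  moreover have "\<forall>j\<in>{1..s}. \<eta> j \<ge> 0"
    using wit unfolding assmA3_witness_def by auto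
  ultimately show ?thesis
    unfolding r_primal_def by (intro Sup_upper) blast
qed

section \<open>The barycentre of a representing measure\<close>

lemma max_degree_ge:
  shows "total_degree f \<le> max_degree f g \<psi> s p" "total_degree g \<le> max_degree f g \<psi> s p"
    "degree_x p \<le> max_degree f g \<psi> s p"
    "j \<in> {1..s} \<Longrightarrow> total_degree (\<psi> j) \<le> max_degree f g \<psi> s p"
  unfolding max_degree_def by (rule Max_ge; simp)+

lemma barycentre_feasible:
  assumes A1: "assmA1 f g \<psi> s p Y" and Cy: "Cy \<subseteq> nonneg_polys Y"
    and feas: "L \<in> dual_feasible g \<psi> s p Cx Cy"
    and rep: "represents (max_degree f g \<psi> s p) \<nu> L" and pos: "L 1 > 0"
  shows "(\<chi> i. L (Var i) / L 1) \<in> feasible \<psi> s p Y"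
proof -
  let ?c = "\<chi> i. L (Var i) / L 1"
  have L: "linear L"
    using feas unfolding dual_feasible_def dual_cone_def by auto
  \<comment> \<open>Jensen's inequality transfers the constraints of (D) on \<open>L\<close> to
    constraints at the point \<open>?c\<close>.\<close>
  have nonpos: "peval q ?c \<le> 0"
    if "total_degree q \<le> max_degree f g \<psi> s p" "convex_on UNIV (peval q)" "L q \<le> 0" for q
    using represents_jensen[OF rep L pos that(1,2)] that(3) pos
    by (meson mult_le_0_iff order_trans not_le)
  have "peval (\<psi> j) ?c \<le> 0" if "j \<in> {1..s}" for j
    using that A1 feas max_degree_ge(4)[OF that]
    by (intro nonpos) (auto simp: assmA1_def dual_feasible_def)
  moreover have "peval2 p ?c y \<le> 0" if y: "y \<in> Y" for y
  proof -
    let ?q = "apply_y (\<lambda>h. peval h y) p"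
    \<comment> \<open>The exchange rule with evaluation at \<open>y\<close> in the role of
      \<open>H\<close>; the sign then follows from \<open>- apply_x L p\<close> being nonnegative on
      \<open>Y\<close>.\<close>
    have "L ?q = peval (apply_x L p) y"
      by (rule linear_apply_y_eq_apply_x[OF L linear_peval])
    moreover have "0 \<le> peval (- apply_x L p) y"
      using feas Cy y unfolding dual_feasible_def nonneg_polys_def by auto
    ultimately have "L ?q \<le> 0"
      by (simp add: linear_neg[OF linear_peval])
    moreover have "convex_on UNIV (peval ?q)"
      using A1 y unfolding assmA1_def by (simp add: peval_apply_y_peval[abs_def])
    moreover have "total_degree ?q \<le> max_degree f g \<psi> s p"
      using total_degree_apply_y_le max_degree_ge(3) by (rule order_trans)
    ultimately show ?thesis
      using nonpos[of ?q] by (simp add: peval_apply_y_peval)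
  qed
  ultimately show ?thesis
    unfolding feasible_def by simp
qed

text \<open>With \<open>c\<close> the barycentre, Jensen's inequality gives
  \<open>peval f c * L 1 \<le> L f\<close> and \<open>peval g c * L 1 \<ge> 1\<close>. Combining
  them requires \<open>peval f c \<ge> 0\<close> or equality in the second, which are the two
  alternatives of (A2).\<close>

lemma barycentre_value_le:
  assumes A1: "assmA1 f g \<psi> s p Y" and A2: "assmA2 f g (feasible \<psi> s p Y)"
    and L: "linear L" and Lg: "L g = 1"
    and rep: "represents (max_degree f g \<psi> s p) \<nu> L" and pos: "L 1 > 0"
    and feas: "(\<chi> i. L (Var i) / L 1) \<in> feasible \<psi> s p Y"
  shows "peval f (\<chi> i. L (Var i) / L 1) / peval g (\<chi> i. L (Var i) / L 1) \<le> L f"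
proof -
  define c where "c = (\<chi> i. L (Var i) / L 1)"
  note jensen = represents_jensen[OF rep L pos, folded c_def]
  have cK: "c \<in> feasible \<psi> s p Y"
    using feas unfolding c_def .
  have g_pos: "peval g c > 0"
    using A2 cK unfolding assmA2_def by auto
  have f_le: "peval f c * L 1 \<le> L f"
    using A1 by (intro jensen max_degree_ge) (simp add: assmA1_def)
  have "peval (- g) = (\<lambda>x. - peval g x)"
    by (simp add: fun_eq_iff linear_neg[OF linear_peval])
  moreover have "keys (- g) = keys g"
    by (auto simp: in_keys_iff)
  ultimately have g_ge: "peval g c * L 1 \<ge> 1"
    using jensen[of "- g"] A1 max_degree_ge(2)[of g f \<psi> s p] Lg
    by (simp add: assmA1_def total_degree_def linear_neg[OF L])
  have "peval f c \<le> peval f c * (peval g c * L 1)"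
    using A2 unfolding assmA2_def
  proof
    assume "\<forall>x\<in>feasible \<psi> s p Y. peval f x \<ge> 0 \<and> peval g x > 0"
    then show ?thesis
      using cK g_ge mult_left_mono[of 1 "peval g c * L 1" "peval f c"] by simp
  next
    assume "affine_fun (peval g) \<and> (\<forall>x\<in>feasible \<psi> s p Y. peval g x > 0)"
    \<comment> \<open>The reverse inequality, so the product is exactly 1 and the sign of
      \<open>peval f c\<close> does not matter.\<close>
    then have "peval g c * L 1 \<le> 1"
      using jensen[of g] max_degree_ge(2)[of g f \<psi> s p] Lg by (simp add: convex_on_affine_fun)
    then show ?thesis
      using g_ge by simp
  qed
  also have "\<dots> = peval f c * L 1 * peval g c"
    by (simp add: mult_ac)
  also have "\<dots> \<le> L f * peval g c"
    using f_le g_pos by (intro mult_right_mono) auto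
  finally show ?thesis
    using g_pos unfolding c_def[symmetric] by (simp add: pos_divide_le_eq)
qed

text \<open>The moment formula is stated for degree bound at least 1, since a measure representing
  \<open>L\<close> only on constants does not determine \<open>L (Var i)\<close>. Membership of the
  point in the set of \<epsilon>-minimizers is claimed for every degree bound.\<close>

theorem theorem3p1:
  fixes f g :: "'m::finite mpoly"
    and \<psi> :: "nat \<Rightarrow> 'm mpoly" and s :: nat
    and p :: "('m, 'n::finite) bipoly"
    and Y :: "(real ^ 'n) set"
    and Cx :: "'m mpoly set" and Cy :: "'n mpoly set"
    and \<epsilon> :: real
  assumes S_nonempty: "minimizers f g (feasible \<psi> s p Y) \<noteq> {}"
    and A1: "assmA1 f g \<psi> s p Y"
    and A2: "assmA2 f g (feasible \<psi> s p Y)"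
    and Cx: "convex_cone Cx"
    and Cy: "convex_cone Cy" "Cy \<subseteq> nonneg_polys Y"
    and eps: "\<epsilon> \<ge> 0"
    and u: "\<exists>u \<in> eps_minimizers f g (feasible \<psi> s p Y) \<epsilon>.
              - subst_x p u \<in> Cy \<and> (\<forall>h\<in>Cx. peval h u \<ge> 0)"
  shows
    "(\<forall>\<mu> \<eta>. assmA3_witness f g \<psi> s p Y \<mu> \<eta> \<longrightarrow>
        lagrangian_poly f g \<psi> s p Y \<mu> \<eta> + \<epsilon> *\<^sub>R g \<in> Cx \<longrightarrow>
        ereal (rstar f g (feasible \<psi> s p Y) - \<epsilon>) \<le> r_primal f g \<psi> s p Cx Cy \<and>
        r_primal f g \<psi> s p Cx Cy \<le> r_dual f g \<psi> s p Cx Cy \<and>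
        r_dual f g \<psi> s p Cx Cy \<le> ereal (rstar f g (feasible \<psi> s p Y) + \<epsilon>))
     \<and>
     (\<forall>L \<nu>. dual_minimizer f g \<psi> s p Cx Cy L \<longrightarrow>
        represents (max_degree f g \<psi> s p) \<nu> L \<longrightarrow>
        ereal (rstar f g (feasible \<psi> s p Y)) \<le> r_dual f g \<psi> s p Cx Cy \<and>
        r_dual f g \<psi> s p Cx Cy \<le> ereal (rstar f g (feasible \<psi> s p Y) + \<epsilon>) \<and>
        (max_degree f g \<psi> s p \<ge> 1 \<longrightarrow>
          (\<chi> i. L (Var i) / L 1) = (1 / (LINT x|\<nu>. 1)) *\<^sub>R (\<chi> i. LINT x|\<nu>. x $ i)) \<and>
        (\<chi> i. L (Var i) / L 1) \<in> eps_minimizers f g (feasible \<psi> s p Y) \<epsilon>)"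
proof -
  let ?K = "feasible \<psi> s p Y"
  obtain u where u: "u \<in> ?K" "peval f u / peval g u \<le> rstar f g ?K + \<epsilon>"
    "- subst_x p u \<in> Cy" "\<forall>h\<in>Cx. peval h u \<ge> 0"
    using u unfolding eps_minimizers_def by auto
  have "peval g u > 0"
    using A2 u(1) unfolding assmA2_def by auto
  then have "r_dual f g \<psi> s p Cx Cy \<le> ereal (peval f u / peval g u)"
    by (intro r_dual_le_point_evaluation[OF Cy(1) u(1,3,4)])
  also have "\<dots> \<le> ereal (rstar f g ?K + \<epsilon>)"
    using u(2) by simp
  finally have upper: "r_dual f g \<psi> s p Cx Cy \<le> ereal (rstar f g ?K + \<epsilon>)" .
  show ?thesis
  \<comment> \<open>This settles (i), whose leftover premises are closed by assumption at
    \<open>qed\<close>, and the upper bound in (ii).\<close>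
  proof (intro conjI allI impI upper weak_duality r_primal_ge[OF A1 Cy(2)])
    fix L \<nu>
    assume min: "dual_minimizer f g \<psi> s p Cx Cy L"
      and rep: "represents (max_degree f g \<psi> s p) \<nu> L"
    let ?c = "\<chi> i. L (Var i) / L 1"
    have feas: "L \<in> dual_feasible g \<psi> s p Cx Cy"
      and "\<And>M. M \<in> dual_feasible g \<psi> s p Cx Cy \<Longrightarrow> L f \<le> M f"
      using min unfolding dual_minimizer_def is_arg_min_linorder by auto
    \<comment> \<open>The infimum is attained at \<open>L\<close>, so the extended real value is
      finite and comparable with the objective at \<open>?c\<close>.\<close>
    then have r_dual: "r_dual f g \<psi> s p Cx Cy = ereal (L f)"
      unfolding r_dual_def by (intro antisym INF_lower INF_greatest) auto
    have L: "linear L" and Lg: "L g = 1"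
      using feas unfolding dual_feasible_def dual_cone_def by auto
    have pos: "L 1 > 0"
      using represents_mass_pos[OF rep L max_degree_ge(2)] Lg by simp
    have cK: "?c \<in> ?K"
      by (rule barycentre_feasible[OF A1 Cy(2) feas rep pos])
    have c_le: "peval f ?c / peval g ?c \<le> L f"
      by (rule barycentre_value_le[OF A1 A2 L Lg rep pos cK])
    show "ereal (rstar f g ?K) \<le> r_dual f g \<psi> s p Cx Cy"
      using rstar_le[OF S_nonempty cK] c_le by (simp add: r_dual)
    show "?c \<in> eps_minimizers f g ?K \<epsilon>"
      using cK c_le upper unfolding r_dual eps_minimizers_def by simp
    show "?c = (1 / (LINT x|\<nu>. 1)) *\<^sub>R (\<chi> i. LINT x|\<nu>. x $ i)"
      if "max_degree f g \<psi> s p \<ge> 1"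
      using represents_Var(2)[OF rep that] represents_mass(2)[OF rep] by (simp add: vec_eq_iff)
  qed
qed

end
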